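(* For $w\in\mathcal I_n$, the matrix $\Phi(w)$ belongs to $\mathrm{Mono}_n$ if and only if $w$ is non-decreasing. Thus, under the bijection $\Phi$ between $\mathcal I_n$ and $\mathrm{Par}_n$, the matrices in $\mathrm{Mono}_n$ correspond exactly to the non-decreasing inversion tables.
   Context: $[a,b]=\{i\in\mathbb Z:a\le i\le b\}$. $\mathcal I_n$ is the set of integer sequences $(x_1,\dots,x_n)$ with $0\le x_\ell\le \ell-1$; such a sequence is non-decreasing if $x_i\le x_{i+1}$ for $1\le i<n$. A partition matrix on $[1,n]$ is a square upper triangular matrix whose entries are subsets of $[1,n]$ such that: (i) every row and column contains a non-empty entry; (ii) the non-empty entries partition $[1,n]$; (iii) $\mathrm{col}(i)<\mathrm{col}(j)$ implies $i<j$, where $\mathrm{col}(i)$ and $\mathrm{row}(i)$ are the column and row indices of the entry containing $i$. $\mathrm{Par}_n$ is the set of these, and $\mathrm{Mono}_n$ is the set of $A\in\mathrm{Par}_n$ which also satisfy (iv) $\mathrm{row}(i)<\mathrm{row}(j)$ implies $i<j$. For $w=(x_1,\dots,x_n)\in\mathcal I_n$ with set of distinct entries $\{y_1<\dots<y_k\}$ and $y_{k+1}:=n$, $\Phi(w)$ is the $k\times k$ matrix whose $(i,j)$ entry is $\{\ell\in[1,n]: x_\ell=y_i\text{ and }y_j<\ell\le y_{j+1}\}$; $\Phi$ is a bijection $\mathcal I_n\to\mathrm{Par}_n$. *)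

theory Defs
  imports "Jordan_Normal_Form.Matrix" "HOL-Library.Disjoint_Sets"
begin

text \<open>The sequence (x_1, ..., x_n) is encoded as a list \<open>w\<close> with x_l = \<open>w ! (l - 1)\<close>;
  the elements of [1,n] themselves stay 1-based.\<close>

definition inversion_tables :: "nat \<Rightarrow> nat list set" where
  "inversion_tables n = {w. length w = n \<and> (\<forall>l\<in>{1..n}. w ! (l - 1) \<le> l - 1)}"

text \<open>Rows and columns of \<open>nat set mat\<close> are indexed from 0. This shift does not matter, since
  row and column indices are only ever compared with each other.\<close>

definition row_of :: "nat set mat \<Rightarrow> nat \<Rightarrow> nat" where
  "row_of A x = (THE i. i < dim_row A \<and> (\<exists>j < dim_col A. x \<in> A $$ (i, j)))"

definition col_of :: "nat set mat \<Rightarrow> nat \<Rightarrow> nat" where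
  "col_of A x = (THE j. j < dim_col A \<and> (\<exists>i < dim_row A. x \<in> A $$ (i, j)))"

text \<open>The partition condition is imposed on the family of entries indexed by their positions, not
  on the set of entries: the same non-empty set must not occur at two positions.\<close>

definition Par_mats :: "nat \<Rightarrow> nat set mat set" where
  "Par_mats n = {A. square_mat A
     \<and> (\<forall>i < dim_row A. \<forall>j < dim_col A. j < i \<longrightarrow> A $$ (i, j) = {})
     \<and> (\<forall>i < dim_row A. \<exists>j < dim_col A. A $$ (i, j) \<noteq> {})
     \<and> (\<forall>j < dim_col A. \<exists>i < dim_row A. A $$ (i, j) \<noteq> {})
     \<and> disjoint_family_on (\<lambda>p. A $$ p) ({..<dim_row A} \<times> {..<dim_col A})
     \<and> (\<Union>p \<in> {..<dim_row A} \<times> {..<dim_col A}. A $$ p) = {1..n}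
     \<and> (\<forall>x\<in>{1..n}. \<forall>y\<in>{1..n}. col_of A x < col_of A y \<longrightarrow> x < y)}"

definition Mono_mats :: "nat \<Rightarrow> nat set mat set" where
  "Mono_mats n = {A \<in> Par_mats n. \<forall>x\<in>{1..n}. \<forall>y\<in>{1..n}. row_of A x < row_of A y \<longrightarrow> x < y}"

text \<open>The list \<open>y\<close> is y_1 < ... < y_k followed by y_(k+1) = n.\<close>

definition Phi :: "nat list \<Rightarrow> nat set mat" where
  "Phi w = (let n = length w;
                k = card (set w);
                y = sorted_list_of_set (set w) @ [n]
            in mat k k (\<lambda>(i, j). {l \<in> {1..n}. w ! (l - 1) = y ! i \<and> y ! j < l \<and> l \<le> y ! (j + 1)}))"

end

theory Submission
  imports Defs
begin

text \<open>Columns of a partition matrix are consecutive intervals of [1,n], so the matrix is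
  determined by the cut points between its columns together with the row of every element. For
  \<open>Phi w\<close> the cut points are the distinct values of \<open>w\<close>, and the row of \<open>l\<close> is the rank of x_l
  among them; hence replacing every \<open>l\<close> by the cut point numbered by its row inverts \<open>Phi\<close>, and
  comparing rows amounts to comparing the entries of \<open>w\<close>.\<close>

text \<open>A non-empty \<open>S\<close> is filled up to its maximum, so its size is also its last
  element; this allows cut points to be defined by counting.\<close>

lemma down_closed_eq_atLeastAtMost_card:
  fixes S :: "nat set"
  assumes "finite S" "0 \<notin> S" and down: "\<And>x y. y \<in> S \<Longrightarrow> 1 \<le> x \<Longrightarrow> x \<le> y \<Longrightarrow> x \<in> S"
  shows "S = {1..card S}"
proof (cases "S = {}")
  case False
  with assms have "Max S \<in> S" by simp
  have "x \<in> S \<longleftrightarrow> x \<in> {1..Max S}" for x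
    using assms(1,2) down[OF \<open>Max S \<in> S\<close>, of x] by (cases x) auto
  then have eq: "S = {1..Max S}" by blast
  then have "card S = Max S"
    using card_atLeastAtMost[of 1 "Max S"] by simp
  with eq show ?thesis by simp
qed simp

text \<open>Disjointness supplies the uniqueness that the descriptions in \<open>row_of\<close> and
  \<open>col_of\<close> require. It is assumed directly, so that the fact also serves
  \<open>Phi w\<close> before that is known to be a partition matrix.\<close>

lemma mat_positions_eq:
  assumes "disjoint_family_on (\<lambda>p. A $$ p) ({..<dim_row A} \<times> {..<dim_col A})"
    and "i < dim_row A" "j < dim_col A" "x \<in> A $$ (i, j)"
  shows "row_of A x = i" "col_of A x = j"
proof -
  have uniq: "i' = i \<and> j' = j"
    if "i' < dim_row A" "j' < dim_col A" "x \<in> A $$ (i', j')" for i' j'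
    using disjoint_family_onD[OF assms(1), of "(i', j')" "(i, j)"] that assms(2-4) by auto
  show "row_of A x = i" "col_of A x = j"
    unfolding row_of_def col_of_def using assms(2-4) uniq by (blast intro: the_equality)+
qed

subsection \<open>Partition matrices\<close>

lemma Par_matsD:
  assumes "A \<in> Par_mats n"
  shows Par_mats_dim_col: "dim_col A = dim_row A"
    and Par_mats_upper: "i < dim_row A \<Longrightarrow> j < dim_row A \<Longrightarrow> j < i \<Longrightarrow> A $$ (i, j) = {}"
    and Par_mats_row_entry: "i < dim_row A \<Longrightarrow> \<exists>j < dim_row A. A $$ (i, j) \<noteq> {}"
    and Par_mats_col_entry: "j < dim_row A \<Longrightarrow> \<exists>i < dim_row A. A $$ (i, j) \<noteq> {}"
    and Par_mats_disjoint: "disjoint_family_on (\<lambda>p. A $$ p) ({..<dim_row A} \<times> {..<dim_row A})"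
    and Par_mats_Union: "(\<Union>p \<in> {..<dim_row A} \<times> {..<dim_row A}. A $$ p) = {1..n}"
    and Par_mats_col_less:
      "x \<in> {1..n} \<Longrightarrow> y \<in> {1..n} \<Longrightarrow> col_of A x < col_of A y \<Longrightarrow> x < y"
proof -
  have sq: "dim_col A = dim_row A" using assms by (simp add: Par_mats_def)
  show "dim_col A = dim_row A"
    "i < dim_row A \<Longrightarrow> j < dim_row A \<Longrightarrow> j < i \<Longrightarrow> A $$ (i, j) = {}"
    "i < dim_row A \<Longrightarrow> \<exists>j < dim_row A. A $$ (i, j) \<noteq> {}"
    "j < dim_row A \<Longrightarrow> \<exists>i < dim_row A. A $$ (i, j) \<noteq> {}"
    "disjoint_family_on (\<lambda>p. A $$ p) ({..<dim_row A} \<times> {..<dim_row A})"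
    "(\<Union>p \<in> {..<dim_row A} \<times> {..<dim_row A}. A $$ p) = {1..n}"
    "x \<in> {1..n} \<Longrightarrow> y \<in> {1..n} \<Longrightarrow> col_of A x < col_of A y \<Longrightarrow> x < y"
    using assms unfolding Par_mats_def mem_Collect_eq sq by blast+
qed

lemma Par_mats_entryD:
  assumes "A \<in> Par_mats n" "i < dim_row A" "j < dim_row A" "x \<in> A $$ (i, j)"
  shows "x \<in> {1..n}" "row_of A x = i" "col_of A x = j"
proof -
  show "x \<in> {1..n}"
    using assms(2-4) unfolding Par_mats_Union[OF assms(1), symmetric] by blast
  show "row_of A x = i" "col_of A x = j"
    using mat_positions_eq[of A i j x] Par_mats_disjoint[OF assms(1)] Par_mats_dim_col[OF assms(1)]
      assms(2-4) by simp_all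
qed

lemma Par_mats_position:
  assumes A: "A \<in> Par_mats n" and x: "x \<in> {1..n}"
  shows "row_of A x < dim_row A" "col_of A x < dim_row A" "row_of A x \<le> col_of A x"
    "x \<in> A $$ (row_of A x, col_of A x)"
proof -
  obtain i j where ij: "i < dim_row A" "j < dim_row A" "x \<in> A $$ (i, j)"
    using x unfolding Par_mats_Union[OF A, symmetric] by blast
  moreover have "i \<le> j"
    using Par_mats_upper[OF A ij(1,2)] ij(3) by (cases "j < i") auto
  ultimately show "row_of A x < dim_row A" "col_of A x < dim_row A"
    "row_of A x \<le> col_of A x" "x \<in> A $$ (row_of A x, col_of A x)"
    using Par_mats_entryD[OF A ij] by auto
qed

text \<open>Every entry is recovered from \<open>row_of\<close> and \<open>col_of\<close>;
  \<open>Phi_Phi_inv\<close> compares matrices in this form.\<close>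

lemma Par_mats_entry_eq:
  assumes "A \<in> Par_mats n" "i < dim_row A" "j < dim_row A"
  shows "A $$ (i, j) = {x \<in> {1..n}. row_of A x = i \<and> col_of A x = j}"
  using assms Par_mats_entryD[OF assms] Par_mats_position(4)[OF assms(1)] by blast

lemma Par_mats_row_nonempty:
  assumes "A \<in> Par_mats n" "i < dim_row A"
  obtains x where "x \<in> {1..n}" "row_of A x = i"
proof -
  obtain j x where "j < dim_row A" "x \<in> A $$ (i, j)"
    using Par_mats_row_entry[OF assms] by blast
  then show thesis using that Par_mats_entryD[OF assms] by blast
qed

lemma Par_mats_col_nonempty:
  assumes "A \<in> Par_mats n" "j < dim_row A"
  obtains x where "x \<in> {1..n}" "col_of A x = j"
proof -
  obtain i x where "i < dim_row A" "x \<in> A $$ (i, j)"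
    using Par_mats_col_entry[OF assms] by blast
  then show thesis using that Par_mats_entryD[OF assms(1) _ assms(2)] by blast
qed

text \<open>For a partition matrix this is the last element before column \<open>j\<close>. Counting
  yields 0 for \<open>j = 0\<close> without taking a maximum of an empty set.\<close>

definition col_cut :: "nat \<Rightarrow> nat set mat \<Rightarrow> nat \<Rightarrow> nat" where
  "col_cut n A j = card {x \<in> {1..n}. col_of A x < j}"

text \<open>Condition (iii) makes the set of elements in columns before \<open>j\<close> downward
  closed, so it is an initial segment of [1,n] that ends at its cardinality.\<close>

lemma col_less_iff_le_col_cut:
  assumes A: "A \<in> Par_mats n" and x: "x \<in> {1..n}"
  shows "col_of A x < j \<longleftrightarrow> x \<le> col_cut n A j"
proof -
  let ?S = "{x \<in> {1..n}. col_of A x < j}"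
  have "?S = {1..card ?S}"
  proof (rule down_closed_eq_atLeastAtMost_card)
    fix a b assume ab: "b \<in> ?S" "1 \<le> a" "a \<le> b"
    then have "a \<in> {1..n}" by auto
    moreover have "\<not> col_of A b < col_of A a"
      using Par_mats_col_less[OF A, of b a] ab by auto
    ultimately show "a \<in> ?S" using ab by auto
  qed auto
  then have "x \<in> ?S \<longleftrightarrow> x \<in> {1..card ?S}" by (rule arg_cong)
  with x show ?thesis by (simp add: col_cut_def)
qed

text \<open>Strictness comes from the non-empty column: an element of column \<open>j\<close> lies
  above the cut before it and not above the cut after it.\<close>

lemma col_cut_less_Suc:
  assumes "A \<in> Par_mats n" "j < dim_row A"
  shows "col_cut n A j < col_cut n A (Suc j)"
proof -
  obtain x where "x \<in> {1..n}" "col_of A x = j"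
    using Par_mats_col_nonempty[OF assms] .
  then show ?thesis
    using col_less_iff_le_col_cut[OF assms(1), of x j]
      col_less_iff_le_col_cut[OF assms(1), of x "Suc j"] by simp
qed

lemma col_cut_less:
  assumes A: "A \<in> Par_mats n" and "i < j" "j \<le> dim_row A"
  shows "col_cut n A i < col_cut n A j"
  using assms(2,3)
proof (induction j)
  case (Suc j)
  then show ?case
    using col_cut_less_Suc[OF A, of j] by (cases "i = j") auto
qed simp

lemma col_cut_dim_row:
  assumes "A \<in> Par_mats n"
  shows "col_cut n A (dim_row A) = n"
proof -
  have "{x \<in> {1..n}. col_of A x < dim_row A} = {1..n}"
    using Par_mats_position(2)[OF assms] by auto
  then show ?thesis by (simp add: col_cut_def)
qed

section \<open>The inverse map\<close>

definition Phi_inv :: "nat \<Rightarrow> nat set mat \<Rightarrow> nat list" where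
  "Phi_inv n A = map (\<lambda>l. col_cut n A (row_of A l)) [1..<Suc n]"

lemma length_Phi_inv [simp]: "length (Phi_inv n A) = n"
  by (simp add: Phi_inv_def)

lemma nth_Phi_inv:
  "l \<in> {1..n} \<Longrightarrow> Phi_inv n A ! (l - 1) = col_cut n A (row_of A l)"
  by (auto simp: Phi_inv_def simp del: upt_Suc)

text \<open>Upper triangularity bounds the entries: the column of \<open>l\<close> is not before the
  index of its row, so \<open>l\<close> lies beyond the cut with that index.\<close>

lemma Phi_inv_in_inversion_tables:
  assumes A: "A \<in> Par_mats n"
  shows "Phi_inv n A \<in> inversion_tables n"
proof -
  have "col_cut n A (row_of A l) \<le> l - 1" if l: "l \<in> {1..n}" for l
    using col_less_iff_le_col_cut[OF A l, of "row_of A l"] Par_mats_position(3)[OF A l] by simp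
  then show ?thesis unfolding inversion_tables_def by (simp add: nth_Phi_inv[simplified])
qed

text \<open>Since every row is non-empty, every cut before the final one occurs as an entry, and the
  cuts are strictly increasing.\<close>

lemma sorted_list_of_set_Phi_inv:
  assumes A: "A \<in> Par_mats n"
  shows "sorted_list_of_set (set (Phi_inv n A)) = map (col_cut n A) [0..<dim_row A]"
proof (rule strict_sorted_equal)
  show "sorted_wrt (<) (map (col_cut n A) [0..<dim_row A])"
    using col_cut_less[OF A] by (auto simp: sorted_wrt_iff_nth_less)
  have "row_of A ` {1..n} = {..<dim_row A}"
    using Par_mats_position(1)[OF A] Par_mats_row_nonempty[OF A] by blast
  then have "set (Phi_inv n A) = col_cut n A ` {..<dim_row A}"
    unfolding Phi_inv_def
    by (auto simp: image_image[symmetric] atLeastLessThanSuc_atLeastAtMost simp del: upt_Suc)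
  then show "set (sorted_list_of_set (set (Phi_inv n A)))
    = set (map (col_cut n A) [0..<dim_row A])"
    by (auto simp: atLeast0LessThan)
qed simp

subsection \<open>The matrix of an inversion table\<close>

text \<open>The list y_1, ..., y_(k+1) of \<open>Phi\<close>, indexed from 0: column
  \<open>j\<close> holds the \<open>l\<close> with
  \<open>cuts w ! j < l \<le> cuts w ! Suc j\<close>, and the appended length closes the last
  column.\<close>

definition cuts :: "nat list \<Rightarrow> nat list" where
  "cuts w = sorted_list_of_set (set w) @ [length w]"

lemma dim_Phi [simp]: "dim_row (Phi w) = card (set w)" "dim_col (Phi w) = card (set w)"
  by (simp_all add: Phi_def Let_def)

lemma Phi_entry:
  assumes "i < card (set w)" "j < card (set w)"
  shows "Phi w $$ (i, j)
    = {l \<in> {1..length w}. w ! (l - 1) = cuts w ! i \<and> cuts w ! j < l \<and> l \<le> cuts w ! Suc j}"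
  using assms by (simp add: Phi_def Let_def cuts_def)

lemma length_cuts [simp]: "length (cuts w) = Suc (card (set w))"
  by (simp add: cuts_def)

lemma cuts_last: "cuts w ! card (set w) = length w"
  by (simp add: cuts_def nth_append)

lemma Phi_Phi_inv:
  assumes A: "A \<in> Par_mats n"
  shows "Phi (Phi_inv n A) = A"
proof -
  let ?w = "Phi_inv n A"
  note sl = sorted_list_of_set_Phi_inv[OF A]
  from arg_cong[OF sl, of length] have k: "card (set ?w) = dim_row A" by simp
  \<comment> \<open>The index \<open>dim_row A\<close> falls on the appended length
    \<open>n\<close>, which is also the cut after the last column.\<close>
  have cuts: "cuts ?w ! j = col_cut n A j" if "j \<le> dim_row A" for j
    using that col_cut_dim_row[OF A] by (auto simp: cuts_def sl nth_append)
  \<comment> \<open>Distinct rows have distinct cuts, so the entry at \<open>l\<close> determines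
    the row of \<open>l\<close>.\<close>
  have inj: "col_cut n A i = col_cut n A j \<longleftrightarrow> i = j" if "i < dim_row A" "j < dim_row A" for i j
    using col_cut_less[OF A, of i j] col_cut_less[OF A, of j i] that
    by (metis less_imp_le linorder_neqE_nat less_irrefl)
  show ?thesis
  proof (rule eq_matI)
    fix i j assume "i < dim_row A" "j < dim_col A"
    then have ij: "i < dim_row A" "j < dim_row A"
      by (simp_all add: Par_mats_dim_col[OF A])
    \<comment> \<open>The two inequalities say that \<open>l\<close> is in no column before
      \<open>j\<close> but in one before \<open>Suc j\<close>.\<close>
    have "?w ! (l - 1) = cuts ?w ! i \<and> cuts ?w ! j < l \<and> l \<le> cuts ?w ! Suc j
        \<longleftrightarrow> row_of A l = i \<and> col_of A l = j" if l: "l \<in> {1..n}" for l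
      using col_less_iff_le_col_cut[OF A l, of j] col_less_iff_le_col_cut[OF A l, of "Suc j"]
        inj[OF Par_mats_position(1)[OF A l] ij(1)] ij
      by (auto simp: cuts nth_Phi_inv[OF l, simplified])
    then show "Phi ?w $$ (i, j) = A $$ (i, j)"
      unfolding Par_mats_entry_eq[OF A ij] using ij by (auto simp: Phi_entry k)
  qed (simp_all add: k Par_mats_dim_col[OF A])
qed

section \<open>Cut points of an inversion table\<close>

lemma inversion_table_nth:
  assumes "w \<in> inversion_tables n" "l \<in> {1..n}"
  shows "w ! (l - 1) \<in> set w" "w ! (l - 1) < l"
  using assms by (force simp: inversion_tables_def)+

lemma inversion_table_entry_less:
  assumes "w \<in> inversion_tables n" "x \<in> set w"
  shows "x < n"
proof -
  obtain i where "i < n" "x = w ! i"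
    using assms by (auto simp: inversion_tables_def in_set_conv_nth)
  then show ?thesis
    using inversion_table_nth(2)[OF assms(1), of "Suc i"] by simp
qed

text \<open>All values lie below \<open>n\<close>, so appending the length keeps the sorted list of
  distinct values strictly increasing.\<close>

lemma cuts_strict_sorted:
  assumes "w \<in> inversion_tables n"
  shows "sorted_wrt (<) (cuts w)"
  using inversion_table_entry_less[OF assms] assms
  by (auto simp: cuts_def sorted_wrt_append inversion_tables_def)

lemma cuts_less:
  assumes "w \<in> inversion_tables n" "i < j" "j \<le> card (set w)"
  shows "cuts w ! i < cuts w ! j"
  using cuts_strict_sorted[OF assms(1)] assms(2,3) by (simp add: sorted_wrt_iff_nth_less)

lemma cuts_less_iff:
  assumes "w \<in> inversion_tables n" "i \<le> card (set w)" "j \<le> card (set w)"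
  shows "cuts w ! i < cuts w ! j \<longleftrightarrow> i < j"
  using cuts_less[OF assms(1)] assms(2,3) by (metis less_asym linorder_neqE_nat less_irrefl)

lemma cuts_in_set:
  assumes "i < card (set w)"
  shows "cuts w ! i \<in> set w"
proof -
  have "sorted_list_of_set (set w) ! i \<in> set (sorted_list_of_set (set w))"
    using assms by (intro nth_mem) simp
  then show ?thesis using assms by (simp add: cuts_def nth_append)
qed

lemma cuts_rank:
  assumes "x \<in> set w"
  obtains i where "i < card (set w)" "cuts w ! i = x"
proof -
  from assms have "x \<in> set (sorted_list_of_set (set w))" by simp
  then obtain i where "i < card (set w)" "sorted_list_of_set (set w) ! i = x"
    by (metis in_set_conv_nth length_sorted_list_of_set)
  then show thesis using that[of i] by (simp add: cuts_def nth_append)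
qed

text \<open>The first entry must be 0, so 0 is the least value; for the empty table index 0 reaches
  the appended length, which is 0 as well.\<close>

lemma cuts_0:
  assumes w: "w \<in> inversion_tables n"
  shows "cuts w ! 0 = 0"
proof (cases "n = 0")
  case True
  with w show ?thesis by (simp add: inversion_tables_def cuts_def)
next
  case False
  then have "0 \<in> set w"
    using inversion_table_nth[OF w, of 1] by simp
  then obtain i where "i < card (set w)" "cuts w ! i = 0" by (rule cuts_rank)
  then show ?thesis using cuts_less[OF w, of 0 i] by (cases "i = 0") auto
qed

section \<open>Positions in \<open>Phi w\<close>\<close>

lemma Phi_position_exists:
  assumes w: "w \<in> inversion_tables n" and l: "l \<in> {1..n}"
  obtains i j where "i < card (set w)" "j < card (set w)" "l \<in> Phi w $$ (i, j)"
proof -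
  obtain i where i: "i < card (set w)" "cuts w ! i = w ! (l - 1)"
    using cuts_rank[OF inversion_table_nth(1)[OF w l]] .
  have n: "length w = n" using w by (simp add: inversion_tables_def)
  \<comment> \<open>The column of \<open>l\<close> ends at the first cut not below \<open>l\<close>.
    Such a cut exists because the last one is \<open>n\<close>; it has a predecessor because the cut
    at index 0 is 0.\<close>
  define m where "m = (LEAST m. l \<le> cuts w ! m)"
  have ex: "l \<le> cuts w ! card (set w)" using l n by (simp add: cuts_last)
  have m: "l \<le> cuts w ! m" "m \<le> card (set w)"
    unfolding m_def using ex by (auto intro: LeastI Least_le)
  have "m \<noteq> 0" using m(1) cuts_0[OF w] l by (cases m) auto
  then obtain j where j: "m = Suc j" by (cases m) auto
  have "\<not> l \<le> cuts w ! j" using j not_less_Least[of j "\<lambda>m. l \<le> cuts w ! m"] by (simp add: m_def)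
  then have "l \<in> Phi w $$ (i, j)"
    using i j m l n by (simp add: Phi_entry)
  then show thesis using that[of i j] i(1) j m(2) by simp
qed

text \<open>The row is fixed by injectivity of the cuts. If two column intervals share an element,
  then \<open>j < Suc j'\<close> and \<open>j' < Suc j\<close>, so they coincide.\<close>

lemma Phi_disjoint:
  assumes w: "w \<in> inversion_tables n"
  shows "disjoint_family_on (\<lambda>p. Phi w $$ p) ({..<card (set w)} \<times> {..<card (set w)})"
proof -
  have "i = i' \<and> j = j'"
    if b: "i < card (set w)" "j < card (set w)" "i' < card (set w)" "j' < card (set w)"
      and x: "x \<in> Phi w $$ (i, j)" "x \<in> Phi w $$ (i', j')" for i j i' j' x
  proof -
    have "cuts w ! i = cuts w ! i'" "cuts w ! j < cuts w ! Suc j'" "cuts w ! j' < cuts w ! Suc j"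
      using b x by (auto simp: Phi_entry)
    then show ?thesis
      using cuts_less_iff[OF w, of i i'] cuts_less_iff[OF w, of i' i]
        cuts_less_iff[OF w, of j "Suc j'"] cuts_less_iff[OF w, of j' "Suc j"] b by simp
  qed
  then show ?thesis unfolding disjoint_family_on_def by fastforce
qed

lemma Phi_position:
  assumes w: "w \<in> inversion_tables n" and l: "l \<in> {1..n}"
  shows "row_of (Phi w) l < card (set w)" "col_of (Phi w) l < card (set w)"
    "w ! (l - 1) = cuts w ! row_of (Phi w) l"
    "cuts w ! col_of (Phi w) l < l" "l \<le> cuts w ! Suc (col_of (Phi w) l)"
proof -
  obtain i j where ij: "i < card (set w)" "j < card (set w)" "l \<in> Phi w $$ (i, j)"
    using Phi_position_exists[OF w l] .
  have "row_of (Phi w) l = i" "col_of (Phi w) l = j"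
    using mat_positions_eq[of "Phi w" i j l] Phi_disjoint[OF w] ij by simp_all
  with ij show "row_of (Phi w) l < card (set w)" "col_of (Phi w) l < card (set w)"
    "w ! (l - 1) = cuts w ! row_of (Phi w) l"
    "cuts w ! col_of (Phi w) l < l" "l \<le> cuts w ! Suc (col_of (Phi w) l)"
    by (simp_all add: Phi_entry)
qed

lemma Phi_row_less_iff:
  assumes w: "w \<in> inversion_tables n" and "x \<in> {1..n}" "y \<in> {1..n}"
  shows "row_of (Phi w) x < row_of (Phi w) y \<longleftrightarrow> w ! (x - 1) < w ! (y - 1)"
  using Phi_position[OF w assms(2)] Phi_position[OF w assms(3)] by (simp add: cuts_less_iff[OF w])

text \<open>Counterpart of \<open>col_less_iff_le_col_cut\<close>, taken from the intervals that
  define \<open>Phi w\<close>, since membership in \<open>Par_mats n\<close> is derived from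
  it.\<close>

lemma Phi_col_less_iff:
  assumes w: "w \<in> inversion_tables n" and l: "l \<in> {1..n}" and j: "j \<le> card (set w)"
  shows "col_of (Phi w) l < j \<longleftrightarrow> l \<le> cuts w ! j"
proof
  note p = Phi_position[OF w l]
  assume "col_of (Phi w) l < j"
  then have "\<not> cuts w ! j < cuts w ! Suc (col_of (Phi w) l)"
    using j p(2) by (simp add: cuts_less_iff[OF w])
  then show "l \<le> cuts w ! j" using p(5) by linarith
next
  note p = Phi_position[OF w l]
  assume "l \<le> cuts w ! j"
  then have "cuts w ! col_of (Phi w) l < cuts w ! j" using p(4) by linarith
  then show "col_of (Phi w) l < j" using p(2) j by (simp add: cuts_less_iff[OF w])
qed

section \<open>\<open>Phi\<close> as an invertible map into the partition matrices\<close>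

lemma Phi_in_Par_mats:
  assumes w: "w \<in> inversion_tables n"
  shows "Phi w \<in> Par_mats n"
proof -
  let ?k = "card (set w)"
  have n: "length w = n" using w by (simp add: inversion_tables_def)
  \<comment> \<open>An element \<open>l\<close> of this entry has \<open>cuts w ! i\<close> = x_l <
    l \<le> \<open>cuts w ! Suc j\<close>, the strict inequality being the inversion table
    condition; this forces i \<le> j.\<close>
  have upper: "Phi w $$ (i, j) = {}" if ij: "i < ?k" "j < ?k" "j < i" for i j
  proof (rule ccontr)
    assume "Phi w $$ (i, j) \<noteq> {}"
    then obtain l where "l \<in> Phi w $$ (i, j)" by blast
    then have l: "l \<in> {1..n}" "w ! (l - 1) = cuts w ! i" "l \<le> cuts w ! Suc j"
      using ij n by (simp_all add: Phi_entry)
    from l(2,3) have "cuts w ! i < cuts w ! Suc j"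
      using inversion_table_nth(2)[OF w l(1)] by simp
    with ij show False by (simp add: cuts_less_iff[OF w])
  qed
  have rows: "\<exists>j<?k. Phi w $$ (i, j) \<noteq> {}" if i: "i < ?k" for i
  proof -
    obtain m where m: "m < n" "w ! m = cuts w ! i"
      using cuts_in_set[OF i] n by (auto simp: in_set_conv_nth)
    then have "Suc m \<in> {1..n}" by simp
    from Phi_position[OF w this] m n i show ?thesis
      by (intro exI[of _ "col_of (Phi w) (Suc m)"] conjI) (auto simp: Phi_entry)
  qed
  have cols: "\<exists>i<?k. Phi w $$ (i, j) \<noteq> {}" if j: "j < ?k" for j
  proof -
    \<comment> \<open>The first element of column \<open>j\<close>; it is at most \<open>n\<close>
      because entries of an inversion table are below \<open>n\<close>.\<close>
    let ?l = "Suc (cuts w ! j)"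
    have l: "?l \<in> {1..n}"
      using inversion_table_entry_less[OF w cuts_in_set[OF j]] by simp
    have "?l \<le> cuts w ! Suc j"
      using cuts_less[OF w, of j "Suc j"] j by simp
    then have "?l \<in> Phi w $$ (row_of (Phi w) ?l, j)"
      using Phi_position(1,3)[OF w l] j l n by (simp add: Phi_entry)
    then show ?thesis using Phi_position(1)[OF w l] by blast
  qed
  have union: "(\<Union>p \<in> {..<?k} \<times> {..<?k}. Phi w $$ p) = {1..n}"
  proof
    show "(\<Union>p \<in> {..<?k} \<times> {..<?k}. Phi w $$ p) \<subseteq> {1..n}"
      using n by (auto simp: Phi_entry)
    show "{1..n} \<subseteq> (\<Union>p \<in> {..<?k} \<times> {..<?k}. Phi w $$ p)"
      by (rule subsetI, erule Phi_position_exists[OF w]) blast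
  qed
  \<comment> \<open>The cut before the column of \<open>y\<close> separates the two:
    \<open>x\<close> is at most that cut and \<open>y\<close> is above it.\<close>
  have "x < y" if "x \<in> {1..n}" "y \<in> {1..n}" "col_of (Phi w) x < col_of (Phi w) y" for x y
    using Phi_col_less_iff[OF w that(1), of "col_of (Phi w) y"] Phi_position(2,4)[OF w that(2)]
      that(3) by simp
  with upper rows cols union Phi_disjoint[OF w] show ?thesis
    unfolding Par_mats_def by simp
qed

text \<open>Counting the elements before column \<open>r\<close> of \<open>Phi w\<close> gives back
  the cut with index \<open>r\<close>; when \<open>r\<close> is the row of \<open>l\<close>, this
  cut is x_l.\<close>

lemma Phi_inv_Phi:
  assumes w: "w \<in> inversion_tables n"
  shows "Phi_inv n (Phi w) = w"
proof (rule nth_equalityI)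
  have n: "length w = n" using w by (simp add: inversion_tables_def)
  then show "length (Phi_inv n (Phi w)) = length w" by simp
  fix m assume "m < length (Phi_inv n (Phi w))"
  then have m: "Suc m \<in> {1..n}" by simp
  let ?r = "row_of (Phi w) (Suc m)"
  have r: "?r < card (set w)" by (rule Phi_position(1)[OF w m])
  \<comment> \<open>This bound keeps \<open>{1..cuts w ! ?r}\<close> inside [1,n].\<close>
  have "cuts w ! ?r < n"
    using inversion_table_entry_less[OF w cuts_in_set[OF r]] .
  then have "{x \<in> {1..n}. col_of (Phi w) x < ?r} = {1..cuts w ! ?r}"
    using Phi_col_less_iff[OF w, of _ ?r] r by auto
  then have "col_cut n (Phi w) ?r = cuts w ! ?r" by (simp add: col_cut_def)
  then show "Phi_inv n (Phi w) ! m = w ! m"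
    using nth_Phi_inv[OF m] Phi_position(3)[OF w m] by simp
qed

section \<open>Monotone matrices\<close>

lemma Phi_in_Mono_mats_iff:
  assumes w: "w \<in> inversion_tables n"
  shows "Phi w \<in> Mono_mats n \<longleftrightarrow> sorted w"
proof -
  have n: "length w = n" using w by (simp add: inversion_tables_def)
  have "Phi w \<in> Mono_mats n
      \<longleftrightarrow> (\<forall>x\<in>{1..n}. \<forall>y\<in>{1..n}. w ! (x - 1) < w ! (y - 1) \<longrightarrow> x < y)"
    using Phi_in_Par_mats[OF w] by (auto simp: Mono_mats_def Phi_row_less_iff[OF w])
  \<comment> \<open>Shift to 0-based positions: [1,n] is the image under \<open>Suc\<close> of the
    numbers below \<open>n\<close>.\<close>
  also have "\<dots> \<longleftrightarrow> (\<forall>i<n. \<forall>j<n. w ! i < w ! j \<longrightarrow> i < j)"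
    unfolding image_Suc_lessThan[symmetric] by auto
  \<comment> \<open>Contraposition, with the roles of \<open>i\<close> and \<open>j\<close>
    exchanged.\<close>
  also have "\<dots> \<longleftrightarrow> (\<forall>i<n. \<forall>j<n. i \<le> j \<longrightarrow> w ! i \<le> w ! j)"
    unfolding not_less[symmetric] by blast
  also have "\<dots> \<longleftrightarrow> sorted w"
    unfolding sorted_iff_nth_mono n by (auto intro: le_less_trans)
  finally show ?thesis .
qed

theorem theorem8:
  fixes n :: nat
  shows "(\<forall>w \<in> inversion_tables n. Phi w \<in> Mono_mats n \<longleftrightarrow> sorted w)
    \<and> bij_betw Phi (inversion_tables n) (Par_mats n)
    \<and> bij_betw Phi {w \<in> inversion_tables n. sorted w} (Mono_mats n)"
proof (intro conjI ballI)
  show "Phi w \<in> Mono_mats n \<longleftrightarrow> sorted w" if "w \<in> inversion_tables n" for w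
    using that by (rule Phi_in_Mono_mats_iff)
  show bij: "bij_betw Phi (inversion_tables n) (Par_mats n)"
    by (rule bij_betw_byWitness[where f' = "Phi_inv n"])
      (auto simp: Phi_inv_Phi Phi_Phi_inv Phi_in_Par_mats Phi_inv_in_inversion_tables)
  \<comment> \<open>Surjectivity onto \<open>Par_mats n\<close> provides a preimage of each monotone
    matrix; the equivalence then shows that this preimage is sorted.\<close>
  have "Mono_mats n \<subseteq> Phi ` inversion_tables n"
    unfolding bij_betw_imp_surj_on[OF bij] by (auto simp: Mono_mats_def)
  then have "Phi ` {w \<in> inversion_tables n. sorted w} = Mono_mats n"
    using Phi_in_Mono_mats_iff by blast
  then show "bij_betw Phi {w \<in> inversion_tables n. sorted w} (Mono_mats n)"
    using bij by (blast intro: bij_betw_subset)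
qed

end
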